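(* Let $u(q,p,t)\in \mathrm{Lip}(\mathbb{R}^3,\mathbb{R})$, let $M=\{(q,p)\in\mathbb{R}^2 : 0<q<\pi\}$, let $t_0\in\mathbb{R}$, and let $\mu\in M$ be an equilibrium of the system $$\dot q=p,\qquad \dot p=u(q,p,t)\,\sin q-\cos q .$$ Suppose there exist a closed subset $U\subset M$ with $\mu\in U\setminus\partial U$ and a $C^1$-function $V\colon U\to\mathbb{R}$ such that (L1) $V(\mu)=0$ and $V>0$ on $U\setminus\{\mu\}$; (L2) the derivative $\dot V$ of $V$ along the system is negative on $U\setminus\{\mu\}$ for all $t$. Then there exist an initial condition $(q_0,p_0)$ at $t=t_0$ and an open neighborhood $B\subset M$ of $\mu$ such that the solution of the system with $(q(t_0),p(t_0))=(q_0,p_0)$ satisfies $(q(t),p(t))\in M\setminus B$ for all $t\geqslant t_0$ in its maximal interval of existence.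
   Context: $\mathrm{Lip}(\mathbb{R}^3,\mathbb{R})$ denotes the set of functions $u\colon\mathbb{R}^3\to\mathbb{R}$, $u=u(q,p,t)$, that are continuous and locally Lipschitz (i.e. Lipschitz on every compact $K\subset\mathbb{R}^3$) in all variables except $t$. No periodicity in $q$ or $t$ is assumed. The system describes an inverted pendulum of unit mass and length, in a gravity field with unit acceleration, whose pivot point moves horizontally with acceleration $u$. The values $q=0$ and $q=\pi$ are the horizontal positions of the rod, and $q=\pi/2$ is the vertical upward position. The system is considered for $(q,p)\in\mathbb{R}^2$, with no constraint on $q$. An equilibrium $\mu$ is a point of the phase space at which the right-hand side of the system vanishes for all $t$. The derivative of $V$ along the system is $\dot V(q,p,t)=\partial_qV(q,p)\,p+\partial_pV(q,p)\,\bigl(u(q,p,t)\sin q-\cos q\bigr)$. *)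

theory Defs
  imports "HOL-Analysis.Analysis"
begin

text \<open>
  Functions of \<open>(q, p, t)\<close> that are jointly continuous and, on every compact set, Lipschitz in
  \<open>(q, p)\<close>; the Lipschitz constant may depend on the compact set but not on \<open>t\<close>.
\<close>

definition Lip :: "(real \<Rightarrow> real \<Rightarrow> real \<Rightarrow> real) set" where
  "Lip = {u. continuous_on UNIV (\<lambda>(q, p, t). u q p t) \<and>
     (\<forall>K :: (real \<times> real \<times> real) set. compact K \<longrightarrow>
        (\<exists>L. \<forall>t. L-lipschitz_on {(q, p). (q, p, t) \<in> K} (\<lambda>(q, p). u q p t)))}"

definition strip :: "(real \<times> real) set" where
  "strip = {(q, p). 0 < q \<and> q < pi}"

definition pendulum :: "(real \<Rightarrow> real \<Rightarrow> real \<Rightarrow> real) \<Rightarrow> real \<Rightarrow> real \<times> real \<Rightarrow> real \<times> real" where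
  "pendulum u t = (\<lambda>(q, p). (p, u q p t * sin q - cos q))"

definition equilibrium :: "(real \<Rightarrow> real \<Rightarrow> real \<Rightarrow> real) \<Rightarrow> real \<times> real \<Rightarrow> bool" where
  "equilibrium u \<mu> \<longleftrightarrow> (\<forall>t. pendulum u t \<mu> = 0)"

definition solution_on ::
  "(real \<Rightarrow> real \<Rightarrow> real \<Rightarrow> real) \<Rightarrow> (real \<Rightarrow> real \<times> real) \<Rightarrow> real set \<Rightarrow> bool" where
  "solution_on u x I \<longleftrightarrow> open I \<and> is_interval I \<and>
     (\<forall>t\<in>I. (x has_vector_derivative pendulum u t (x t)) (at t))"

text \<open>
  A solution of the initial value problem on its maximal interval of existence \<open>I\<close>: it has no
  extension to a strictly larger interval. The values of \<open>x\<close> outside \<open>I\<close> are irrelevant.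
\<close>

definition maximal_solution ::
  "(real \<Rightarrow> real \<Rightarrow> real \<Rightarrow> real) \<Rightarrow> real \<Rightarrow> real \<times> real \<Rightarrow> (real \<Rightarrow> real \<times> real) \<Rightarrow> real set \<Rightarrow> bool"
where
  "maximal_solution u t0 x0 x I \<longleftrightarrow> solution_on u x I \<and> t0 \<in> I \<and> x t0 = x0 \<and>
     (\<forall>y J. solution_on u y J \<and> I \<subseteq> J \<and> (\<forall>t\<in>I. y t = x t) \<longrightarrow> J = I)"

text \<open>
  A \<open>C\<^sup>1\<close> function on a set that need not be open is, as usual, one that is \<open>C\<^sup>1\<close> on an open
  neighbourhood of the set, so that its partial derivatives make sense at boundary points too.
\<close>

definition C1_on :: "(real \<times> real) set \<Rightarrow> (real \<times> real \<Rightarrow> real) \<Rightarrow> bool" where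
  "C1_on S V \<longleftrightarrow> (\<exists>W. open W \<and> S \<subseteq> W \<and>
     (\<exists>V' :: real \<times> real \<Rightarrow> (real \<times> real) \<Rightarrow>\<^sub>L real.
        (\<forall>x\<in>W. (V has_derivative blinfun_apply (V' x)) (at x)) \<and> continuous_on W V'))"

definition orbital_deriv ::
  "(real \<Rightarrow> real \<Rightarrow> real \<Rightarrow> real) \<Rightarrow> (real \<times> real \<Rightarrow> real) \<Rightarrow> real \<Rightarrow> real \<Rightarrow> real \<Rightarrow> real" where
  "orbital_deriv u V q p t =
     deriv (\<lambda>s. V (s, p)) q * p + deriv (\<lambda>s. V (q, s)) p * (u q p t * sin q - cos q)"

end

theory Submission
  imports Defs
begin

text \<open>
  The argument is of Wazewski type. Let \<open>C = {V \<le> v}\<close> be a small closed sublevel set of \<open>V\<close> around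
  \<open>\<mu>\<close>, with interior part \<open>B\<close>. A solution starting in the strip outside \<open>C\<close> can leave \<open>strip - B\<close>
  only through \<open>q = 0\<close>, through \<open>q = \<pi>\<close>, or into \<open>B\<close>, and each time strictly: at \<open>q = 0\<close> either
  \<open>p < 0\<close>, or \<open>p = 0\<close> and \<open>p\<close> decreases at rate \<open>-1\<close>; similarly at \<open>q = \<pi>\<close>; on the boundary of \<open>C\<close>
  the function \<open>V\<close> decreases along solutions. By continuous dependence the three sets of initial
  points, sorted by the first way of leaving, are therefore open, and they are disjoint. The segment
  \<open>p = q - c\<close>, \<open>0 \<le> q \<le> \<pi>\<close>, with \<open>0 < c < \<pi>\<close> different from the first coordinate of \<open>\<mu>\<close>, avoids \<open>C\<close>,
  starts in the first set and ends in the second. It is connected, so one of its points lies in none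
  of the three sets.
\<close>

section \<open>Locally Lipschitz ordinary differential equations\<close>

lemma antiderivative_exists:
  fixes g :: "real \<Rightarrow> 'a::euclidean_space"
  assumes "continuous_on UNIV g"
  shows "\<exists>G. G t0 = 0 \<and> (\<forall>t. (G has_vector_derivative g t) (at t))"
proof -
  \<comment> \<open>At most one of the two integrals runs over a nondegenerate interval, so
    \<open>G t\<close> is the signed integral from \<open>t0\<close> to \<open>t\<close> on either
    side of \<open>t0\<close>.\<close>
  define G where "G t = integral {t0..t} g - integral {t..t0} g" for t
  have int: "g integrable_on {a..b}" for a b
    using assms integrable_continuous_real continuous_on_subset by blast
  have "(G has_vector_derivative g t) (at t)" for t
  proof -
    define a b where "a = min t t0 - 1" and "b = max t t0 + 1"
    \<comment> \<open>With \<open>a\<close> to the left of both \<open>t0\<close> and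
      \<open>t\<close>, \<open>G\<close> is near \<open>t\<close> an ordinary integral from
      \<open>a\<close> minus a constant, and the fundamental theorem of calculus applies.\<close>
    have G: "G s = integral {a..s} g - integral {a..t0} g" if "s \<in> {a..b}" for s
    proof (cases "s \<le> t0")
      case True
      then show ?thesis
        using that Henstock_Kurzweil_Integration.integral_combine[of a s t0 g] int
        by (cases "s = t0") (auto simp: G_def algebra_simps)
    next
      case False
      then show ?thesis
        using that Henstock_Kurzweil_Integration.integral_combine[of a t0 s g] int
        by (auto simp: G_def a_def algebra_simps)
    qed
    have t: "t \<in> {a<..<b}" by (auto simp: a_def b_def)
    have "((\<lambda>s. integral {a..s} g) has_vector_derivative g t) (at t within {a..b})"
      using t assms by (intro integral_has_vector_derivative) (auto intro: continuous_on_subset)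
    then have "((\<lambda>s. integral {a..s} g) has_vector_derivative g t) (at t)"
      using t by (simp add: at_within_Icc_at)
    then have "((\<lambda>s. integral {a..s} g - integral {a..t0} g) has_vector_derivative g t - 0) (at t)"
      by (intro derivative_intros)
    then show ?thesis
      unfolding diff_0_right
      by (rule has_vector_derivative_transform_within_open[where S = "{a<..<b}"]) (use t G in auto)
  qed
  moreover have "G t0 = 0" by (simp add: G_def)
  ultimately show ?thesis by blast
qed

text \<open>Mean value inequality against an antiderivative of the bound, on each side of
  \<open>t0\<close> separately; the term \<open>K / k\<close> left over at \<open>t0\<close> has a
  favourable sign and is dropped. The gained factor \<open>1 / k\<close> is what makes the Picard
  operator contract.\<close>

lemma norm_le_exp_of_deriv_le_exp:
  fixes G :: "real \<Rightarrow> 'a::real_normed_vector"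
  assumes "k > 0" and G0: "G t0 = 0"
    and G': "\<And>s. (G has_vector_derivative g s) (at s)"
    and bnd: "\<And>s. norm (g s) \<le> K * exp (k * \<bar>s - t0\<bar>)"
  shows "norm (G t) \<le> K / k * exp (k * \<bar>t - t0\<bar>)"
proof -
  have K: "0 \<le> K"
    using order_trans[OF norm_ge_zero bnd[of t0]] by simp
  have cont: "continuous_on S G" for S
    using G' by (meson continuous_at_imp_continuous_on has_vector_derivative_continuous)
  consider "t = t0" | "t0 < t" | "t < t0" by linarith
  then show ?thesis
  proof cases
    case 1
    then show ?thesis using K \<open>k > 0\<close> by (simp add: G0)
  next
    case 2
    have "norm (G t - G t0) \<le> K / k * exp (k * (t - t0)) - K / k * exp (k * (t0 - t0))"
    proof (rule differentiable_bound_general[OF 2 cont])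
      show "continuous_on {t0..t} (\<lambda>s. K / k * exp (k * (s - t0)))"
        by (intro continuous_intros)
      show "(G has_vector_derivative g s) (at s)" for s by (rule G')
      show "((\<lambda>s. K / k * exp (k * (s - t0))) has_vector_derivative K * exp (k * (s - t0))) (at s)" for s
        unfolding has_real_derivative_iff_has_vector_derivative[symmetric]
        using \<open>k > 0\<close> by (auto intro!: derivative_eq_intros)
      show "norm (g s) \<le> K * exp (k * (s - t0))" if "t0 < s" for s
        using bnd[of s] that by simp
    qed
    then show ?thesis using 2 K \<open>k > 0\<close> by (simp add: G0) (smt (verit) divide_nonneg_pos)
  next
    case 3
    have "norm (G t0 - G t) \<le> - (K / k * exp (k * (t0 - t0))) - - (K / k * exp (k * (t0 - t)))"
    proof (rule differentiable_bound_general[OF 3 cont])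
      show "continuous_on {t..t0} (\<lambda>s. - (K / k * exp (k * (t0 - s))))"
        by (intro continuous_intros)
      show "(G has_vector_derivative g s) (at s)" for s by (rule G')
      show "((\<lambda>s. - (K / k * exp (k * (t0 - s)))) has_vector_derivative K * exp (k * (t0 - s))) (at s)" for s
        unfolding has_real_derivative_iff_has_vector_derivative[symmetric]
        using \<open>k > 0\<close> by (auto intro!: derivative_eq_intros)
      show "norm (g s) \<le> K * exp (k * (t0 - s))" if "s < t0" for s
        using bnd[of s] that by simp
    qed
    then show ?thesis using 3 K \<open>k > 0\<close> by (simp add: G0) (smt (verit) divide_nonneg_pos)
  qed
qed

text \<open>
  Picard iteration in the sup norm weighted by \<open>exp (-k \<bar>t - t0\<bar>)\<close>, which makes the integral
  operator a contraction on the whole time axis at once.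
\<close>

lemma global_solution:
  fixes f :: "real \<Rightarrow> 'a::euclidean_space \<Rightarrow> 'a"
  assumes cont: "continuous_on UNIV (\<lambda>(t, z). f t z)"
    and lip: "\<And>t. L-lipschitz_on UNIV (f t)"
    and bnd: "\<And>t z. norm (f t z) \<le> M"
  shows "\<exists>y. y t0 = z0 \<and> (\<forall>t. (y has_vector_derivative f t (y t)) (at t))"
proof -
  \<comment> \<open>The contraction constant will be \<open>L / k < 1\<close>; the summand 1 keeps
    \<open>k\<close> positive when \<open>L = 0\<close>.\<close>
  define k where "k = 2 * L + 1"
  have L: "0 \<le> L" using lip lipschitz_on_nonneg by blast
  then have k: "0 < k" by (simp add: k_def)
  have M: "0 \<le> M" using bnd norm_ge_zero order_trans by blast
  define E where "E t = exp (k * \<bar>t - t0\<bar>)" for t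
  have E: "0 < E t" "1 \<le> E t" for t using k by (auto simp: E_def)
  have Ec: "continuous_on UNIV E"
    unfolding E_def by (intro continuous_intros)
  \<comment> \<open>A bounded continuous \<open>w\<close> encodes the curve
    \<open>E t *\<^sub>R w t\<close>, so the sup norm of \<open>w\<close> is the weighted norm of
    the curve and completeness is inherited from the space of bounded continuous functions.\<close>
  define g where "g w t = f t (E t *\<^sub>R apply_bcontfun w t)" for w t
  have gc: "continuous_on UNIV (g w)" for w
  proof -
    have "continuous_on UNIV (\<lambda>t. (t, E t *\<^sub>R apply_bcontfun w t))"
      by (intro continuous_intros Ec) simp
    then show ?thesis
      using continuous_on_compose2[OF cont] unfolding g_def by fastforce
  qed
  define G where "G w = (SOME G. G t0 = 0 \<and> (\<forall>t. (G has_vector_derivative g w t) (at t)))" for w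
  have G: "G w t0 = 0" "(G w has_vector_derivative g w t) (at t)" for w t
    using someI_ex[OF antiderivative_exists[OF gc], of t0 w] unfolding G_def by auto
  have Gc: "continuous_on UNIV (G w)" for w
    using G by (meson continuous_at_imp_continuous_on has_vector_derivative_continuous)
  \<comment> \<open>One Picard step, rescaled by the weight: a fixed point encodes a curve equal to
    \<open>z0\<close> plus the integral of the field along it.\<close>
  define P where "P w t = (1 / E t) *\<^sub>R (z0 + G w t)" for w t
  have P: "P w \<in> bcontfun" for w
  proof (rule bcontfun_normI)
    show "continuous_on UNIV (P w)"
      unfolding P_def using E by (intro continuous_intros Ec Gc) (metis less_irrefl)
    fix t
    have "norm (g w s) \<le> M * E s" for s
      using bnd[of s "E s *\<^sub>R apply_bcontfun w s"] mult_left_mono[OF E(2)[of s] M] by (simp add: g_def)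
    then have "norm (G w t) \<le> M / k * E t"
      unfolding E_def by (intro norm_le_exp_of_deriv_le_exp[OF k G])
    moreover have "norm z0 \<le> norm z0 * E t"
      using E(2)[of t] by (simp add: mult_le_cancel_left1)
    ultimately have "norm (z0 + G w t) \<le> (norm z0 + M / k) * E t"
      using norm_triangle_ineq[of z0 "G w t"] by (simp add: distrib_right)
    moreover have "norm (P w t) = norm (z0 + G w t) / E t"
      using E[of t] by (simp add: P_def del: scaleR_right_distrib)
    ultimately show "norm (P w t) \<le> norm z0 + M / k"
      using E[of t] by (simp add: pos_divide_le_eq)
  qed
  define F where "F w = Bcontfun (P w)" for w
  have F: "apply_bcontfun (F w) = P w" for w
    unfolding F_def using P by (rule Bcontfun_inverse)
  have "dist (F v) (F w) \<le> L / k * dist v w" for v w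
  proof (rule dist_bound)
    fix t
    \<comment> \<open>Unscaling costs a factor \<open>E s\<close>; integration returns it as
      \<open>E t / k\<close>, and the division by \<open>E t\<close> in \<open>P\<close> leaves
      \<open>L / k\<close>.\<close>
    have "norm (g v s - g w s) \<le> (L * dist v w) * E s" for s
    proof -
      have "norm (g v s - g w s) \<le> L * norm (E s *\<^sub>R apply_bcontfun v s - E s *\<^sub>R apply_bcontfun w s)"
        unfolding g_def by (rule lipschitz_on_normD[OF lip]) auto
      also have "\<dots> = L * (E s * dist (apply_bcontfun v s) (apply_bcontfun w s))"
        using E[of s] by (simp add: scaleR_diff_right[symmetric] dist_norm)
      also have "\<dots> \<le> L * (E s * dist v w)"
        using L E[of s] by (intro mult_left_mono dist_bounded) auto
      finally show ?thesis by (simp add: mult_ac)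
    qed
    then have "norm (G v t - G w t) \<le> (L * dist v w) / k * E t"
      unfolding E_def
      by (intro norm_le_exp_of_deriv_le_exp[OF k, where g = "\<lambda>s. g v s - g w s"] derivative_intros G)
        (auto simp: G)
    moreover have "dist (P v t) (P w t) = norm (G v t - G w t) / E t"
      using E[of t] by (simp add: P_def dist_norm scaleR_diff_right[symmetric])
    ultimately show "dist (apply_bcontfun (F v) t) (apply_bcontfun (F w) t) \<le> L / k * dist v w"
      using E[of t] by (simp add: F pos_divide_le_eq)
  qed
  moreover have "0 \<le> L / k" "L / k < 1"
    using L by (auto simp: k_def field_simps)
  ultimately obtain w where w: "F w = w"
    using banach_fix_type[of "L / k" F] by blast
  define y where "y t = z0 + G w t" for t
  have "E t *\<^sub>R apply_bcontfun w t = y t" for t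
    using F[of w] E[of t] by (simp add: w P_def y_def)
  then have "g w t = f t (y t)" for t
    by (simp add: g_def)
  then have "(y has_vector_derivative f t (y t)) (at t)" for t
    unfolding y_def using G(2)[of w t] by (auto intro!: derivative_eq_intros)
  moreover have "y t0 = z0" by (simp add: y_def G)
  ultimately show ?thesis by blast
qed

text \<open>The squared norm is differentiable even where \<open>d\<close> vanishes, and its
  derivative is at most \<open>2 * L\<close> times itself in absolute value. Multiplied by the
  matching decaying exponential it is therefore monotone, forwards and backwards in time.\<close>

lemma gronwall_norm:
  fixes d :: "real \<Rightarrow> 'a::real_inner"
  assumes d': "\<And>s. s \<in> closed_segment t0 t \<Longrightarrow> (d has_vector_derivative d' s) (at s)"
    and bnd: "\<And>s. s \<in> closed_segment t0 t \<Longrightarrow> norm (d' s) \<le> L * norm (d s)"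
  shows "norm (d t) \<le> norm (d t0) * exp (L * \<bar>t - t0\<bar>)"
proof -
  define N where "N s = d s \<bullet> d s" for s
  have N': "(N has_real_derivative 2 * (d s \<bullet> d' s)) (at s)"
    and Nb: "\<bar>2 * (d s \<bullet> d' s)\<bar> \<le> 2 * L * N s" if s: "s \<in> closed_segment t0 t" for s
  proof -
    show "(N has_real_derivative 2 * (d s \<bullet> d' s)) (at s)"
      unfolding has_real_derivative_iff_has_vector_derivative N_def
      using bounded_bilinear.has_vector_derivative[OF bounded_bilinear_inner d'[OF s] d'[OF s]]
      by (simp add: inner_commute)
    have "\<bar>d s \<bullet> d' s\<bar> \<le> norm (d s) * norm (d' s)"
      by (rule Cauchy_Schwarz_ineq2)
    also have "\<dots> \<le> norm (d s) * (L * norm (d s))"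
      using bnd[OF s] by (intro mult_left_mono) auto
    also have "\<dots> = L * N s"
      by (simp add: N_def norm_eq_sqrt_inner)
    finally show "\<bar>2 * (d s \<bullet> d' s)\<bar> \<le> 2 * L * N s" by simp
  qed
  have "N t \<le> N t0 * exp (2 * L * \<bar>t - t0\<bar>)"
  proof (cases "t0 \<le> t")
    case True
    have "N t * exp (- (2 * L * (t - t0))) \<le> N t0 * exp (- (2 * L * (t0 - t0)))"
    proof (rule DERIV_nonpos_imp_nonincreasing[OF True])
      fix s assume "t0 \<le> s" "s \<le> t"
      then have s: "s \<in> closed_segment t0 t" by (simp add: closed_segment_eq_real_ivl)
      have "((\<lambda>s. N s * exp (- (2 * L * (s - t0)))) has_real_derivative
          (2 * (d s \<bullet> d' s) - 2 * L * N s) * exp (- (2 * L * (s - t0)))) (at s)"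
        by (auto intro!: derivative_eq_intros N'[OF s] simp: algebra_simps)
      moreover have "(2 * (d s \<bullet> d' s) - 2 * L * N s) * exp (- (2 * L * (s - t0))) \<le> 0"
        using Nb[OF s] by (intro mult_nonpos_nonneg) auto
      ultimately show "\<exists>y. ((\<lambda>s. N s * exp (- (2 * L * (s - t0)))) has_real_derivative y) (at s) \<and> y \<le> 0"
        by blast
    qed
    then have "N t * inverse (exp (2 * L * (t - t0))) \<le> N t0"
      by (simp only: exp_minus) simp
    then show ?thesis using True by (simp add: pos_divide_le_eq flip: divide_inverse)
  next
    case False
    then have ts: "t \<le> t0" by simp
    have "N t * exp (- (2 * L * (t0 - t))) \<le> N t0 * exp (- (2 * L * (t0 - t0)))"
    proof (rule DERIV_nonneg_imp_nondecreasing[OF ts])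
      fix s assume "t \<le> s" "s \<le> t0"
      then have s: "s \<in> closed_segment t0 t" by (simp add: closed_segment_eq_real_ivl)
      have "((\<lambda>s. N s * exp (- (2 * L * (t0 - s)))) has_real_derivative
          (2 * (d s \<bullet> d' s) + 2 * L * N s) * exp (- (2 * L * (t0 - s)))) (at s)"
        by (auto intro!: derivative_eq_intros N'[OF s] simp: algebra_simps)
      moreover have "(2 * (d s \<bullet> d' s) + 2 * L * N s) * exp (- (2 * L * (t0 - s))) \<ge> 0"
        using Nb[OF s] by (intro mult_nonneg_nonneg) auto
      ultimately show "\<exists>y. ((\<lambda>s. N s * exp (- (2 * L * (t0 - s)))) has_real_derivative y) (at s) \<and> 0 \<le> y"
        by blast
    qed
    then have "N t * inverse (exp (2 * L * (t0 - t))) \<le> N t0"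
      by (simp only: exp_minus) simp
    then show ?thesis using False by (simp add: pos_divide_le_eq flip: divide_inverse)
  qed
  then have "(norm (d t))\<^sup>2 \<le> (norm (d t0) * exp (L * \<bar>t - t0\<bar>))\<^sup>2"
    by (simp add: N_def power_mult_distrib dot_square_norm exp_double[symmetric] mult.assoc)
  then show ?thesis by (rule power2_le_imp_le) simp
qed

section \<open>Local existence, uniqueness, continuous dependence and maximal solutions\<close>

locale lipschitz_ode =
  fixes f :: "real \<Rightarrow> 'a::euclidean_space \<Rightarrow> 'a"
  assumes cont: "continuous_on UNIV (\<lambda>(t, z). f t z)"
    and lip: "\<And>R. \<exists>L. \<forall>t. \<bar>t\<bar> \<le> R \<longrightarrow> L-lipschitz_on (cball 0 R) (f t)"
begin

definition solves :: "(real \<Rightarrow> 'a) \<Rightarrow> real set \<Rightarrow> bool" where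
  "solves x I \<longleftrightarrow> open I \<and> is_interval I \<and> (\<forall>t\<in>I. (x has_vector_derivative f t (x t)) (at t))"

lemma solves_continuous_on: "solves x I \<Longrightarrow> S \<subseteq> I \<Longrightarrow> continuous_on S x"
  unfolding solves_def
  by (meson continuous_at_imp_continuous_on has_vector_derivative_continuous subsetD)

lemma solves_segment: "solves x I \<Longrightarrow> s \<in> I \<Longrightarrow> t \<in> I \<Longrightarrow> closed_segment s t \<subseteq> I"
  unfolding solves_def by (meson closed_segment_subset is_interval_convex)

lemma solves_Icc: "solves x I \<Longrightarrow> s \<in> I \<Longrightarrow> t \<in> I \<Longrightarrow> {s..t} \<subseteq> I"
  unfolding solves_def by (meson interval_subset_is_interval atLeastAtMost_iff mem_is_interval_1_I subsetI)

text \<open>Time is clamped to \<open>[-R, R]\<close> and space projected to the nearest point of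
  the ball. Both maps are continuous with values in a compact set and the projection does not
  increase distances, so the new field meets the hypotheses of
  \<open>global_solution\<close>.\<close>

lemma truncation:
  assumes R: "0 \<le> R"
  obtains h L M where "continuous_on UNIV (\<lambda>(t, z). h t z)" "\<And>t. L-lipschitz_on UNIV (h t)"
    "\<And>t z. norm (h t z) \<le> M" "\<And>t z. \<bar>t\<bar> \<le> R \<Longrightarrow> norm z \<le> R \<Longrightarrow> h t z = f t z"
proof -
  define c where "c = closest_point (cball (0::'a) R)"
  define \<tau> where "\<tau> t = max (- R) (min R t)" for t :: real
  define h where "h t z = f (\<tau> t) (c z)" for t z
  have c_in: "c z \<in> cball 0 R" for z
    unfolding c_def using R by (intro closest_point_in_set) auto
  have \<tau>_in: "\<bar>\<tau> t\<bar> \<le> R" for t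
    using R by (auto simp: \<tau>_def)
  have c_dist: "dist (c y) (c z) \<le> dist y z" for y z
    unfolding c_def using R by (intro closest_point_lipschitz) auto
  have c_cont: "continuous_on UNIV c"
    unfolding c_def using R by (intro continuous_on_closest_point) auto
  have \<tau>_cont: "continuous_on UNIV \<tau>"
    unfolding \<tau>_def by (intro continuous_intros)
  obtain L where L: "\<And>t. \<bar>t\<bar> \<le> R \<Longrightarrow> L-lipschitz_on (cball 0 R) (f t)"
    using lip by blast
  have "continuous_on UNIV (\<lambda>s::real \<times> 'a. (\<tau> (fst s), c (snd s)))"
    by (intro continuous_intros continuous_on_compose2[OF c_cont] continuous_on_compose2[OF \<tau>_cont]) auto
  from continuous_on_compose2[OF cont this]
  have hc: "continuous_on UNIV (\<lambda>(t, z). h t z)"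
    by (simp add: h_def case_prod_unfold)
  have hl: "L-lipschitz_on UNIV (h t)" for t
  proof (rule lipschitz_onI)
    show "0 \<le> L" using L[OF \<tau>_in] lipschitz_on_nonneg by blast
    fix y z
    have "dist (h t y) (h t z) \<le> L * dist (c y) (c z)"
      unfolding h_def by (rule lipschitz_onD[OF L[OF \<tau>_in] c_in c_in])
    also have "\<dots> \<le> L * dist y z"
      using c_dist \<open>0 \<le> L\<close> by (rule mult_left_mono)
    finally show "dist (h t y) (h t z) \<le> L * dist y z" .
  qed
  have "bounded ((\<lambda>(t, z). f t z) ` ({-R..R} \<times> cball 0 R))"
    by (intro compact_imp_bounded compact_continuous_image compact_Times continuous_on_subset[OF cont]) auto
  then obtain M where M: "\<And>t z. \<bar>t\<bar> \<le> R \<Longrightarrow> z \<in> cball 0 R \<Longrightarrow> norm (f t z) \<le> M"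
    unfolding bounded_iff by (fastforce simp: abs_le_iff)
  have "norm (h t z) \<le> M" for t z
    unfolding h_def using M \<tau>_in c_in by blast
  moreover have "h t z = f t z" if "\<bar>t\<bar> \<le> R" "norm z \<le> R" for t z
    using that by (simp add: h_def \<tau>_def c_def closest_point_self abs_le_iff)
  ultimately show ?thesis using that hc hl by blast
qed

lemma local_solution: "\<exists>y J. solves y J \<and> t0 \<in> J \<and> y t0 = z"
proof -
  \<comment> \<open>The margin 1 around \<open>t0\<close> and \<open>z\<close> keeps the truncated
    solution for a short time where truncation changes nothing.\<close>
  define R where "R = max (\<bar>t0\<bar> + 1) (norm z + 1)"
  have "0 \<le> R" by (simp add: R_def)
  then obtain h L M where h: "continuous_on UNIV (\<lambda>(t, z). h t z)" "\<And>t. L-lipschitz_on UNIV (h t)"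
    "\<And>t z. norm (h t z) \<le> M" "\<And>t z. \<bar>t\<bar> \<le> R \<Longrightarrow> norm z \<le> R \<Longrightarrow> h t z = f t z"
    using truncation by metis
  obtain y where y: "y t0 = z" "\<And>t. (y has_vector_derivative h t (y t)) (at t)"
    using global_solution[OF h(1-3)] by blast
  have "isCont y t0" using y(2) by (rule has_vector_derivative_continuous)
  then obtain d where d: "d > 0" "\<And>t. dist t t0 < d \<Longrightarrow> dist (y t) z < 1"
    unfolding continuous_at_eps_delta using y(1) by (metis zero_less_one)
  have "(y has_vector_derivative f t (y t)) (at t)" if t: "t \<in> ball t0 (min d 1)" for t
  proof -
    have "\<bar>t\<bar> \<le> R" using t by (auto simp: R_def dist_real_def)
    moreover have "norm (y t - z) < 1"
      using d(2)[of t] t by (simp add: dist_commute flip: dist_norm)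
    then have "norm (y t) \<le> R"
      using norm_triangle_ineq2[of "y t" z] by (simp add: R_def le_max_iff_disj)
    ultimately show ?thesis using y(2)[of t] h(4) by simp
  qed
  moreover have "is_interval (ball t0 (min d 1))"
    by (simp add: is_interval_convex_1)
  ultimately have "solves y (ball t0 (min d 1))" by (auto simp: solves_def)
  moreover have "t0 \<in> ball t0 (min d 1)" using d(1) by simp
  ultimately show ?thesis using y(1) by blast
qed

text \<open>Between \<open>t0\<close> and \<open>t\<close> both solutions stay in one ball, where a
  single Lipschitz constant serves; Gronwall's inequality then starts from difference 0.\<close>

lemma solves_unique:
  assumes x: "solves x I" "t0 \<in> I" "t \<in> I" and y: "solves y J" "t0 \<in> J" "t \<in> J"
    and eq: "x t0 = y t0"
  shows "x t = y t"
proof -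
  let ?S = "closed_segment t0 t"
  have xS: "?S \<subseteq> I" and yS: "?S \<subseteq> J"
    using x y solves_segment by blast+
  have "bounded ?S" "bounded (x ` ?S)" "bounded (y ` ?S)"
    using solves_continuous_on[OF x(1) xS] solves_continuous_on[OF y(1) yS]
    by (auto intro!: compact_imp_bounded compact_continuous_image)
  then obtain R1 R2 R3 where "\<forall>s\<in>?S. \<bar>s\<bar> \<le> R1" "\<forall>s\<in>?S. norm (x s) \<le> R2" "\<forall>s\<in>?S. norm (y s) \<le> R3"
    unfolding bounded_iff ball_simps real_norm_def by blast
  then obtain R where R: "\<bar>s\<bar> \<le> R" "norm (x s) \<le> R" "norm (y s) \<le> R" if "s \<in> ?S" for s
    by (metis le_max_iff_disj)
  obtain L where L: "\<And>t. \<bar>t\<bar> \<le> R \<Longrightarrow> L-lipschitz_on (cball 0 R) (f t)"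
    using lip by blast
  have "norm (x t - y t) \<le> norm (x t0 - y t0) * exp (L * \<bar>t - t0\<bar>)"
  proof (rule gronwall_norm)
    fix s assume s: "s \<in> ?S"
    then show "((\<lambda>s. x s - y s) has_vector_derivative f s (x s) - f s (y s)) (at s)"
      using x(1) y(1) xS yS by (intro derivative_intros) (auto simp: solves_def)
    show "norm (f s (x s) - f s (y s)) \<le> L * norm (x s - y s)"
      using R[OF s] by (intro lipschitz_on_normD[OF L]) auto
  qed
  then show ?thesis using eq by simp
qed

text \<open>Existence of the nearby solutions up to \<open>T\<close> is part of the claim. The
  truncated equation has global solutions, and Gronwall's inequality keeps them so close to
  \<open>x\<close> that they never notice the truncation.\<close>

lemma solution_depends_continuously:
  assumes x: "solves x I" and t: "t0 \<in> I" "T \<in> I" "t0 \<le> T" and e: "0 < e"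
  shows "\<exists>d>0. \<forall>z. dist z (x t0) < d \<longrightarrow>
    (\<exists>y J. solves y J \<and> {t0..T} \<subseteq> J \<and> y t0 = z \<and> (\<forall>t\<in>{t0..T}. dist (y t) (x t) < e))"
proof -
  have "open I" using x by (simp add: solves_def)
  then obtain e1 e2 where e12: "e1 > 0" "cball t0 e1 \<subseteq> I" "e2 > 0" "cball T e2 \<subseteq> I"
    using t open_contains_cball by meson
  \<comment> \<open>A slightly larger time interval, since \<open>solves\<close> asks for an open
    domain containing \<open>{t0..T}\<close>.\<close>
  define a b where "a = t0 - e1" and "b = T + e2"
  have "a \<in> I" "b \<in> I"
    using e12 by (auto simp: a_def b_def subset_iff dist_real_def)
  then have ab: "{a..b} \<subseteq> I" using solves_Icc[OF x] by blast
  have "bounded (x ` {a..b})"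
    using solves_continuous_on[OF x ab] by (auto intro!: compact_imp_bounded compact_continuous_image)
  then obtain R0 where R0: "\<And>t. t \<in> {a..b} \<Longrightarrow> norm (x t) \<le> R0"
    unfolding bounded_iff by blast
  define R where "R = max (R0 + 1) (max \<bar>a\<bar> \<bar>b\<bar>)"
  have "0 \<le> R" by (simp add: R_def le_max_iff_disj)
  then obtain h L M where h: "continuous_on UNIV (\<lambda>(t, z). h t z)" "\<And>t. L-lipschitz_on UNIV (h t)"
    "\<And>t z. norm (h t z) \<le> M" "\<And>t z. \<bar>t\<bar> \<le> R \<Longrightarrow> norm z \<le> R \<Longrightarrow> h t z = f t z"
    using truncation by metis
  have tR: "\<bar>t\<bar> \<le> R" if "t \<in> {a..b}" for t
    using that by (auto simp: R_def)
  have "0 \<le> L" using h(2) lipschitz_on_nonneg by blast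
  \<comment> \<open>The exponential cancels the largest Gronwall factor on \<open>{a..b}\<close>;
    the 1 in the minimum is the margin built into \<open>R\<close>.\<close>
  define d where "d = min e 1 * exp (- (L * (b - a)))"
  have "d > 0" using e by (simp add: d_def)
  moreover have "\<exists>y J. solves y J \<and> {t0..T} \<subseteq> J \<and> y t0 = z \<and> (\<forall>t\<in>{t0..T}. dist (y t) (x t) < e)"
    if z: "dist z (x t0) < d" for z
  proof -
    obtain y where y: "y t0 = z" "\<And>t. (y has_vector_derivative h t (y t)) (at t)"
      using global_solution[OF h(1-3)] by blast
    have close: "norm (y t - x t) < min e 1" if "t \<in> {a..b}" for t
    proof -
      have seg: "closed_segment t0 t \<subseteq> {a..b}"
        using that t(3) e12 by (auto simp: closed_segment_eq_real_ivl a_def b_def)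
      have "norm (y t - x t) \<le> norm (y t0 - x t0) * exp (L * \<bar>t - t0\<bar>)"
      proof (rule gronwall_norm)
        fix s assume "s \<in> closed_segment t0 t"
        then have s: "s \<in> {a..b}" using seg by blast
        then have "(x has_vector_derivative f s (x s)) (at s)"
          using x ab by (auto simp: solves_def)
        moreover have "norm (x s) \<le> R" using R0[OF s] by (simp add: R_def)
        ultimately have "(x has_vector_derivative h s (x s)) (at s)"
          using h(4) tR[OF s] by simp
        then show "((\<lambda>s. y s - x s) has_vector_derivative h s (y s) - h s (x s)) (at s)"
          by (intro derivative_intros y)
        show "norm (h s (y s) - h s (x s)) \<le> L * norm (y s - x s)"
          by (rule lipschitz_on_normD[OF h(2)]) auto
      qed
      also have "\<dots> \<le> norm (y t0 - x t0) * exp (L * (b - a))"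
        using that t(3) e12 \<open>0 \<le> L\<close>
        by (auto simp: a_def b_def intro!: mult_left_mono)
      also have "\<dots> < d * exp (L * (b - a))"
        using z y(1) by (simp add: dist_norm)
      also have "\<dots> = min e 1"
        by (simp add: d_def mult.assoc flip: exp_add)
      finally show ?thesis .
    qed
    have "(y has_vector_derivative f t (y t)) (at t)" if "t \<in> {a<..<b}" for t
    proof -
      have t: "t \<in> {a..b}" using that by simp
      have "norm (y t) \<le> R"
        using close[OF t] R0[OF t] norm_triangle_ineq2[of "y t" "x t"] by (simp add: R_def le_max_iff_disj)
      then show ?thesis using y(2)[of t] h(4) tR[OF t] by simp
    qed
    then have "solves y {a<..<b}"
      by (auto simp: solves_def is_interval_oo)
    moreover have "{t0..T} \<subseteq> {a<..<b}"
      using e12 by (auto simp: a_def b_def)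
    moreover have "dist (y t) (x t) < e" if "t \<in> {t0..T}" for t
      using close[of t] that e12 by (simp add: dist_norm a_def b_def)
    ultimately show ?thesis using y(1) by blast
  qed
  ultimately show ?thesis by blast
qed

text \<open>The union of all solutions through the initial point: uniqueness makes them agree on
  overlaps, and any extension is itself a member of the union.\<close>

lemma maximal_solution_exists:
  "\<exists>x I. solves x I \<and> t0 \<in> I \<and> x t0 = z \<and>
     (\<forall>y J. solves y J \<and> I \<subseteq> J \<and> (\<forall>t\<in>I. y t = x t) \<longrightarrow> J = I)"
proof -
  define S where "S = {(y, J). solves y J \<and> t0 \<in> J \<and> y t0 = z}"
  define I where "I = \<Union> (snd ` S)"
  \<comment> \<open>The value at \<open>t\<close> is read off from an arbitrary solution defined
    there; \<open>x_eq\<close> shows that the choice does not matter.\<close>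
  define x where "x t = fst (SOME s. s \<in> S \<and> t \<in> snd s) t" for t
  have x_eq: "x t = y t" if S: "(y, J) \<in> S" and t: "t \<in> J" for y J t
  proof -
    have "(SOME s. s \<in> S \<and> t \<in> snd s) \<in> S \<and> t \<in> snd (SOME s. s \<in> S \<and> t \<in> snd s)"
      using someI[of "\<lambda>s. s \<in> S \<and> t \<in> snd s" "(y, J)"] S t by simp
    then show ?thesis
      using S t unfolding x_def S_def
      by (auto simp: case_prod_unfold intro: solves_unique)
  qed
  obtain y0 J0 where y0: "(y0, J0) \<in> S"
    using local_solution unfolding S_def by blast
  then have t0: "t0 \<in> J0" "y0 t0 = z" by (auto simp: S_def)
  have "solves x I"
    unfolding solves_def
  proof (intro conjI ballI)
    show "open I" by (auto simp: I_def S_def solves_def)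
    have "connected I"
      unfolding I_def
    proof (rule connected_Union)
      show "connected J" if "J \<in> snd ` S" for J
        using that by (auto simp: S_def solves_def is_interval_connected)
      show "\<Inter> (snd ` S) \<noteq> {}" by (auto simp: S_def)
    qed
    then show "is_interval I" by (simp add: is_interval_connected_1)
    fix t assume "t \<in> I"
    then obtain y J where y: "(y, J) \<in> S" "t \<in> J" by (auto simp: I_def)
    then have "(y has_vector_derivative f t (y t)) (at t)" "open J"
      by (auto simp: S_def solves_def)
    then show "(x has_vector_derivative f t (x t)) (at t)"
      using y x_eq by (simp add: has_vector_derivative_transform_within_open)
  qed
  moreover have "t0 \<in> I" "x t0 = z"
    using y0 t0 x_eq by (force simp: I_def)+
  moreover have "J = I" if "solves y J" "I \<subseteq> J" "\<forall>t\<in>I. y t = x t" for y J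
  proof -
    have "(y, J) \<in> S" using that \<open>t0 \<in> I\<close> \<open>x t0 = z\<close> by (auto simp: S_def)
    then show ?thesis using that(2) by (auto simp: I_def)
  qed
  ultimately show ?thesis by blast
qed

section \<open>Sets of initial points sorted by where their solutions go\<close>

definition reach :: "real \<Rightarrow> 'a set \<Rightarrow> 'a set \<Rightarrow> 'a set" where
  "reach t0 G H = {z. \<exists>x I T. solves x I \<and> t0 \<in> I \<and> T \<in> I \<and> t0 \<le> T \<and> x t0 = z \<and>
     (\<forall>t\<in>{t0..T}. x t \<in> G) \<and> x T \<in> H}"

text \<open>The piece of orbit over \<open>{t0..T}\<close> is compact, so a whole tube around it
  lies in \<open>G\<close>, and its end has a ball in \<open>H\<close>. Continuous dependence keeps
  nearby solutions in both.\<close>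

lemma open_reach:
  assumes "open G" "open H"
  shows "open (reach t0 G H)"
  unfolding open_dist
proof
  fix z assume "z \<in> reach t0 G H"
  then obtain x I T where x: "solves x I" "t0 \<in> I" "T \<in> I" "t0 \<le> T" "x t0 = z"
    "\<forall>t\<in>{t0..T}. x t \<in> G" "x T \<in> H"
    by (auto simp: reach_def)
  have "compact (x ` {t0..T})"
    using x solves_continuous_on solves_Icc by (intro compact_continuous_image) blast+
  then obtain e1 where e1: "e1 > 0" "(\<Union>y\<in>x ` {t0..T}. ball y e1) \<subseteq> G"
    using compact_subset_open_imp_ball_epsilon_subset \<open>open G\<close> x(6) by (metis image_subsetI)
  obtain e2 where e2: "e2 > 0" "ball (x T) e2 \<subseteq> H"
    using \<open>open H\<close> x(7) open_contains_ball by blast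
  obtain d where d: "d > 0" "\<And>z'. dist z' (x t0) < d \<Longrightarrow>
    \<exists>y J. solves y J \<and> {t0..T} \<subseteq> J \<and> y t0 = z' \<and> (\<forall>t\<in>{t0..T}. dist (y t) (x t) < min e1 e2)"
    using solution_depends_continuously[OF x(1-4), of "min e1 e2"] e1(1) e2(1) by auto
  have "z' \<in> reach t0 G H" if z': "dist z' z < d" for z'
  proof -
    obtain y J where y: "solves y J" "{t0..T} \<subseteq> J" "y t0 = z'"
      "\<And>t. t \<in> {t0..T} \<Longrightarrow> dist (y t) (x t) < min e1 e2"
      using d(2) z' x(5) by blast
    have "\<forall>t\<in>{t0..T}. y t \<in> G"
      using y(4) e1(2) by (fastforce simp: dist_commute)
    moreover have "y T \<in> H"
      using y(4)[of T] e2(2) x(4) by (auto simp: dist_commute)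
    moreover have "t0 \<in> J" "T \<in> J" using y(2) x(4) by auto
    ultimately show ?thesis using y(1,3) x(4) unfolding reach_def by blast
  qed
  then show "\<exists>e>0. \<forall>y. dist y z < e \<longrightarrow> y \<in> reach t0 G H"
    using d(1) by blast
qed

text \<open>By uniqueness both witnesses follow the same solution. At the earlier of the two end
  times it would lie in the target of one set and in the corridor of the other.\<close>

lemma reach_disjoint:
  assumes "G \<inter> H' = {}" "G' \<inter> H = {}"
  shows "reach t0 G H \<inter> reach t0 G' H' = {}"
proof -
  have False if z: "z \<in> reach t0 G H" "z \<in> reach t0 G' H'" for z
  proof -
    obtain x I T where x: "solves x I" "t0 \<in> I" "T \<in> I" "t0 \<le> T" "x t0 = z"
      "\<forall>t\<in>{t0..T}. x t \<in> G" "x T \<in> H"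
      using z(1) unfolding reach_def by blast
    obtain y J S where y: "solves y J" "t0 \<in> J" "S \<in> J" "t0 \<le> S" "y t0 = z"
      "\<forall>t\<in>{t0..S}. y t \<in> G'" "y S \<in> H'"
      using z(2) unfolding reach_def by blast
    show False
    proof (cases "T \<le> S")
      case True
      then have T: "T \<in> {t0..S}" using x(4) by simp
      then have "T \<in> J" using solves_Icc[OF y(1-3)] by blast
      then have "x T = y T" using solves_unique[OF x(1-3) y(1,2)] x(5) y(5) by simp
      then show False using bspec[OF y(6) T] x(7) assms by auto
    next
      case False
      then have S: "S \<in> {t0..T}" using y(4) by simp
      then have "S \<in> I" using solves_Icc[OF x(1-3)] by blast
      then have "x S = y S" using solves_unique[OF x(1,2) _ y(1-3)] x(5) y(5) by simp
      then show False using bspec[OF x(6) S] y(7) assms by auto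
    qed
  qed
  then show ?thesis by blast
qed

text \<open>Touching the edge of \<open>H\<close> is enough if \<open>H\<close> is met at
  arbitrarily small times after \<open>T\<close>: the open corridor \<open>G\<close> leaves room for
  the overshoot.\<close>

lemma reach_immediately:
  assumes x: "solves x I" "t0 \<in> I" "T \<in> I" "t0 \<le> T"
    and G: "open G" "\<And>t. t \<in> {t0..T} \<Longrightarrow> x t \<in> G"
    and H: "\<And>e. e > 0 \<Longrightarrow> \<exists>s\<in>{T<..<T + e}. x s \<in> H"
  shows "x t0 \<in> reach t0 G H"
proof -
  have I: "open I" using x(1) by (simp add: solves_def)
  have "open (I \<inter> x -` G)"
    using solves_continuous_on[OF x(1)] I G(1) by (intro continuous_open_preimage) auto
  moreover have "T \<in> I \<inter> x -` G" using x G(2) by simp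
  ultimately obtain e where e: "e > 0" "ball T e \<subseteq> I \<inter> x -` G"
    using open_contains_ball by blast
  obtain s where s: "s \<in> {T<..<T + e}" "x s \<in> H" using H e(1) by blast
  have "x t \<in> G" if "t \<in> {t0..s}" for t
  proof (cases "t \<le> T")
    case False
    then have "t \<in> ball T e" using s(1) that by (simp add: dist_real_def)
    then show ?thesis using e(2) by blast
  qed (use G(2) that in auto)
  moreover have "s \<in> I" using e(2) s(1) by (auto simp: subset_iff dist_real_def)
  moreover have "t0 \<le> s" using x(4) s(1) by simp
  ultimately show ?thesis using x s(2) unfolding reach_def by blast
qed

end

section \<open>The pendulum\<close>

lemma pendulum_lipschitz_ode:
  assumes "u \<in> Lip"
  shows "lipschitz_ode (pendulum u)"
proof
  have uc: "continuous_on UNIV (\<lambda>(q, p, t). u q p t)"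
    using assms by (simp add: Lip_def)
  have "continuous_on UNIV (\<lambda>s::real \<times> real \<times> real. (fst (snd s), snd (snd s), fst s))"
    by (intro continuous_intros)
  from continuous_on_compose2[OF uc this]
  have "continuous_on UNIV (\<lambda>s. u (fst (snd s)) (snd (snd s)) (fst s))" by simp
  then have "continuous_on UNIV (\<lambda>s. (snd (snd s),
      u (fst (snd s)) (snd (snd s)) (fst s) * sin (fst (snd s)) - cos (fst (snd s))))"
    by (intro continuous_intros)
  then show "continuous_on UNIV (\<lambda>(t, z). pendulum u t z)"
    by (simp add: pendulum_def case_prod_unfold)
  fix R :: real
  define K where "K = {-R..R} \<times> {-R..R} \<times> {-R..R}"
  have K: "compact K" unfolding K_def by (intro compact_Times) auto
  then obtain L where L: "\<And>t. L-lipschitz_on {(q, p). (q, p, t) \<in> K} (\<lambda>(q, p). u q p t)"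
    using assms unfolding Lip_def by blast
  have L0: "0 \<le> L" using L lipschitz_on_nonneg by blast
  have "bounded ((\<lambda>(q, p, t). u q p t) ` K)"
    by (intro compact_imp_bounded compact_continuous_image K continuous_on_subset[OF uc]) simp
  then obtain M where M: "\<And>q p t. (q, p, t) \<in> K \<Longrightarrow> \<bar>u q p t\<bar> \<le> M"
    unfolding bounded_iff by fastforce
  have sin_le: "\<bar>sin a - sin b\<bar> \<le> \<bar>a - b\<bar>" and cos_le: "\<bar>cos a - cos b\<bar> \<le> \<bar>a - b\<bar>" for a b :: real
  proof -
    show "\<bar>sin a - sin b\<bar> \<le> \<bar>a - b\<bar>"
      using field_differentiable_bound[of UNIV sin cos 1 b a]
      by (auto intro: DERIV_sin simp: has_field_derivative_at_within)
    show "\<bar>cos a - cos b\<bar> \<le> \<bar>a - b\<bar>"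
      using field_differentiable_bound[of UNIV cos "\<lambda>x. - sin x" 1 b a]
      by (auto intro: DERIV_cos simp: has_field_derivative_at_within)
  qed
  \<comment> \<open>\<open>L\<close> and \<open>\<bar>M\<bar>\<close> come from the product of
    \<open>u\<close> and \<open>sin\<close>, and 1 each from \<open>cos\<close> and from the first
    component. The absolute value covers \<open>R < 0\<close>, where \<open>K\<close> is empty and
    \<open>M\<close> may be negative.\<close>
  have "(L + \<bar>M\<bar> + 2)-lipschitz_on (cball 0 R) (pendulum u t)" if t: "\<bar>t\<bar> \<le> R" for t
  proof (rule lipschitz_onI)
    show "0 \<le> L + \<bar>M\<bar> + 2" using L0 by simp
    fix y z :: "real \<times> real" assume yz: "y \<in> cball 0 R" "z \<in> cball 0 R"
    obtain a b c d where [simp]: "y = (a, b)" "z = (c, d)" by fastforce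
    have yK: "(a, b, t) \<in> K" "(c, d, t) \<in> K"
      using yz t norm_fst_le[of a b] norm_snd_le[of b a] norm_fst_le[of c d] norm_snd_le[of d c]
      by (auto simp: K_def abs_le_iff)
    define D where "D = norm (y - z)"
    have D: "\<bar>a - c\<bar> \<le> D" "\<bar>b - d\<bar> \<le> D"
      using norm_fst_le[of "a - c" "b - d"] norm_snd_le[of "b - d" "a - c"] by (auto simp: D_def)
    have u: "\<bar>u a b t - u c d t\<bar> \<le> L * D"
      using lipschitz_on_normD[OF L[of t], of "(a, b)" "(c, d)"] yK by (simp add: D_def)
    have "\<bar>u a b t * sin a - u c d t * sin c\<bar>
        = \<bar>(u a b t - u c d t) * sin a + u c d t * (sin a - sin c)\<bar>"
      by (simp add: algebra_simps)
    also have "\<dots> \<le> \<bar>u a b t - u c d t\<bar> * \<bar>sin a\<bar> + \<bar>u c d t\<bar> * \<bar>sin a - sin c\<bar>"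
      by (metis abs_mult abs_triangle_ineq)
    also have "\<dots> \<le> (L * D) * 1 + \<bar>M\<bar> * D"
      using u M[OF yK(2)] sin_le[of a c] D(1) L0 by (intro add_mono mult_mono) (auto simp: D_def)
    finally have "\<bar>u a b t * sin a - u c d t * sin c\<bar> \<le> (L + \<bar>M\<bar>) * D"
      by (simp add: distrib_right)
    then have "\<bar>(u a b t * sin a - cos a) - (u c d t * sin c - cos c)\<bar> \<le> (L + \<bar>M\<bar>) * D + D"
      using cos_le[of a c] D(1) by linarith
    moreover have "norm (pendulum u t y - pendulum u t z)
        \<le> \<bar>b - d\<bar> + \<bar>(u a b t * sin a - cos a) - (u c d t * sin c - cos c)\<bar>"
      using norm_Pair_le[of "b - d" "(u a b t * sin a - cos a) - (u c d t * sin c - cos c)"] by (simp add: pendulum_def)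
    ultimately show "dist (pendulum u t y) (pendulum u t z) \<le> (L + \<bar>M\<bar> + 2) * dist y z"
      using D(2) unfolding dist_norm D_def[symmetric] by (simp add: algebra_simps)
  qed
  then show "\<exists>L. \<forall>t. \<bar>t\<bar> \<le> R \<longrightarrow> L-lipschitz_on (cball 0 R) (pendulum u t)" by blast
qed

text \<open>Links the partial derivatives in the hypothesis on \<open>V\<close> with the total
  derivative, which the chain rule along a solution produces.\<close>

lemma orbital_deriv_eq:
  assumes V: "(V has_derivative D) (at (q, p))"
  shows "orbital_deriv u V q p t = D (pendulum u t (q, p))"
proof -
  interpret D: bounded_linear D using V by (rule has_derivative_bounded_linear)
  have D1: "(\<lambda>h. D (h, 0)) = (*) (D (1, 0))"
  proof
    show "D (h, 0) = D (1, 0) * h" for h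
      using D.scaleR[of h "(1, 0)"] by simp
  qed
  have D2: "(\<lambda>h. D (0, h)) = (*) (D (0, 1))"
  proof
    show "D (0, h) = D (0, 1) * h" for h
      using D.scaleR[of h "(0, 1)"] by simp
  qed
  have "((\<lambda>s. (s, p)) has_derivative (\<lambda>h. (h, 0))) (at q)"
    by (intro derivative_intros)
  from has_derivative_compose[OF this V]
  have "((\<lambda>s. V (s, p)) has_derivative (\<lambda>h. D (h, 0))) (at q)" .
  then have "((\<lambda>s. V (s, p)) has_real_derivative D (1, 0)) (at q)"
    unfolding has_field_derivative_def using D1 by simp
  then have 1: "deriv (\<lambda>s. V (s, p)) q = D (1, 0)" by (rule DERIV_imp_deriv)
  have "((\<lambda>s. (q, s)) has_derivative (\<lambda>h. (0, h))) (at p)"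
    by (intro derivative_intros)
  from has_derivative_compose[OF this V]
  have "((\<lambda>s. V (q, s)) has_derivative (\<lambda>h. D (0, h))) (at p)" .
  then have "((\<lambda>s. V (q, s)) has_real_derivative D (0, 1)) (at p)"
    unfolding has_field_derivative_def using D2 by simp
  then have 2: "deriv (\<lambda>s. V (q, s)) p = D (0, 1)" by (rule DERIV_imp_deriv)
  have D_eq: "D (a, b) = D (1, 0) * a + D (0, 1) * b" for a b
    using D.add[of "(a, 0)" "(0, b)"] fun_cong[OF D1, of a] fun_cong[OF D2, of b] by simp
  show ?thesis unfolding orbital_deriv_def pendulum_def 1 2 prod.case by (rule D_eq[symmetric])
qed

text \<open>A negative velocity at \<open>T\<close> decides at first order. If the velocity is 0,
  its negative derivative makes it negative right after \<open>T\<close>, and the mean value theorem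
  finishes.\<close>

lemma decreasing_of_second_deriv_neg:
  fixes q p :: "real \<Rightarrow> real"
  assumes I: "open I" "T \<in> I"
    and q: "\<And>t. t \<in> I \<Longrightarrow> (q has_real_derivative p t) (at t)"
    and p: "(p has_real_derivative d) (at T)" "p T \<le> 0" "d < 0"
  shows "\<exists>e>0. \<forall>s. T < s \<and> s < T + e \<longrightarrow> q s < q T"
proof (cases "p T < 0")
  case True
  obtain e where e: "e > 0" "\<And>h. 0 < h \<Longrightarrow> h < e \<Longrightarrow> q (T + h) < q T"
    using DERIV_neg_dec_right[OF q[OF I(2)] True] by blast
  have "q s < q T" if "T < s" "s < T + e" for s
    using e(2)[of "s - T"] that by simp
  then show ?thesis using e(1) by blast
next
  case False
  then have "p T = 0" using p(2) by simp
  then obtain e1 where e1: "e1 > 0" "\<And>h. 0 < h \<Longrightarrow> h < e1 \<Longrightarrow> p (T + h) < 0"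
    using DERIV_neg_dec_right[OF p(1,3)] by auto
  obtain e2 where e2: "e2 > 0" "ball T e2 \<subseteq> I"
    using I open_contains_ball by blast
  have "q s < q T" if s: "T < s" "s < T + min e1 e2" for s
  proof (rule DERIV_neg_imp_decreasing_open[OF s(1)])
    have in_I: "r \<in> I" if "T \<le> r" "r \<le> s" for r
      using e2 s that by (auto simp: subset_iff dist_real_def)
    show "\<exists>y. (q has_real_derivative y) (at r) \<and> y < 0" if "T < r" "r < s" for r
      using q[OF in_I, of r] e1(2)[of "r - T"] s that by auto
    show "continuous_on {T..s} q"
      using in_I q by (meson DERIV_isCont atLeastAtMost_iff continuous_at_imp_continuous_on)
  qed
  then show ?thesis using e1(1) e2(1) by (intro exI[of _ "min e1 e2"]) auto
qed

section \<open>Strict exit through the two sides of the strip\<close>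

context
  fixes u :: "real \<Rightarrow> real \<Rightarrow> real \<Rightarrow> real"
  assumes u: "u \<in> Lip"
begin

interpretation lipschitz_ode "pendulum u"
  using u by (rule pendulum_lipschitz_ode)

lemma solution_on_iff_solves: "solution_on u x I \<longleftrightarrow> solves x I"
  by (simp add: solution_on_def solves_def)

lemma solution_components:
  assumes "solves x I" "t \<in> I"
  shows "((\<lambda>t. fst (x t)) has_real_derivative snd (x t)) (at t)"
    and "((\<lambda>t. snd (x t)) has_real_derivative
      u (fst (x t)) (snd (x t)) t * sin (fst (x t)) - cos (fst (x t))) (at t)"
proof -
  have x: "(x has_vector_derivative pendulum u t (x t)) (at t)"
    using assms by (simp add: solves_def)
  show "((\<lambda>t. fst (x t)) has_real_derivative snd (x t)) (at t)"
    using bounded_linear.has_vector_derivative[OF bounded_linear_fst x]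
    by (simp add: has_real_derivative_iff_has_vector_derivative pendulum_def case_prod_unfold)
  show "((\<lambda>t. snd (x t)) has_real_derivative
      u (fst (x t)) (snd (x t)) t * sin (fst (x t)) - cos (fst (x t))) (at t)"
    using bounded_linear.has_vector_derivative[OF bounded_linear_snd x]
    by (simp add: has_real_derivative_iff_has_vector_derivative pendulum_def case_prod_unfold)
qed

text \<open>At \<open>q = 0\<close> the sine vanishes, so \<open>u\<close> drops out and
  \<open>p\<close> has derivative -1. A solution arriving from inside cannot have positive velocity
  there; when \<open>T = t0\<close> there is no past to argue from, hence the extra hypothesis on
  the velocity.\<close>

lemma left_exit:
  assumes C: "closed C" "C \<subseteq> strip"
    and x: "solves x I" "t0 \<in> I" "T \<in> I" "t0 \<le> T"
    and inside: "\<And>s. s \<in> {t0..<T} \<Longrightarrow> x s \<in> strip - C"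
    and T: "fst (x T) = 0" "T = t0 \<Longrightarrow> snd (x T) < 0"
  shows "x t0 \<in> reach t0 ({z. fst z < pi} - C) {z. fst z < 0}"
proof (rule reach_immediately[OF x])
  show "open ({z. fst z < pi} - C)"
    by (intro open_Diff C open_Collect_less continuous_intros)
  show "x t \<in> {z. fst z < pi} - C" if "t \<in> {t0..T}" for t
  proof (cases "t = T")
    case True
    then show ?thesis using T(1) C(2) by (auto simp: strip_def)
  next
    case False
    then show ?thesis using inside[of t] that by (auto simp: strip_def)
  qed
  have "snd (x T) \<le> 0"
  proof (rule ccontr)
    assume "\<not> ?thesis"
    then have pos: "snd (x T) > 0" "t0 < T" using T(2) x(4) by (auto simp: less_le)
    obtain d where d: "d > 0" "\<And>h. 0 < h \<Longrightarrow> h < d \<Longrightarrow> fst (x (T - h)) < fst (x T)"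
      using DERIV_pos_inc_left[OF solution_components(1)[OF x(1,3)] pos(1)] by blast
    \<comment> \<open>The step back is below \<open>d\<close> and does not go past
      \<open>t0\<close>, so it lands at a time when the solution should still be in the
      strip.\<close>
    have "fst (x (T - min (d / 2) (T - t0))) < 0"
      using d(1) d(2)[of "min (d / 2) (T - t0)"] pos(2) T(1) by auto
    moreover have "T - min (d / 2) (T - t0) \<in> {t0..<T}" using d(1) pos(2) by auto
    ultimately show False using inside by (fastforce simp: strip_def)
  qed
  moreover have "open I" using x(1) by (simp add: solves_def)
  ultimately obtain e where e: "e > 0" "\<And>s. T < s \<Longrightarrow> s < T + e \<Longrightarrow> fst (x s) < fst (x T)"
    using decreasing_of_second_deriv_neg[OF _ x(3) solution_components(1)[OF x(1)] solution_components(2)[OF x(1,3)]] T(1)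
    by auto
  show "\<exists>s\<in>{T<..<T + e'}. x s \<in> {z. fst z < 0}" if "e' > 0" for e'
    using e T(1) that by (intro bexI[of _ "T + min e e' / 2"]) auto
qed

text \<open>Mirror image of \<open>left_exit\<close>: at \<open>q = pi\<close> the derivative of
  \<open>p\<close> is 1, and the decrease lemma is applied to the negatives of both
  components.\<close>

lemma right_exit:
  assumes C: "closed C" "C \<subseteq> strip"
    and x: "solves x I" "t0 \<in> I" "T \<in> I" "t0 \<le> T"
    and inside: "\<And>s. s \<in> {t0..<T} \<Longrightarrow> x s \<in> strip - C"
    and T: "fst (x T) = pi" "T = t0 \<Longrightarrow> snd (x T) > 0"
  shows "x t0 \<in> reach t0 ({z. fst z > 0} - C) {z. fst z > pi}"
proof (rule reach_immediately[OF x])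
  show "open ({z. fst z > 0} - C)"
    by (intro open_Diff C open_Collect_less continuous_intros)
  show "x t \<in> {z. fst z > 0} - C" if "t \<in> {t0..T}" for t
  proof (cases "t = T")
    case True
    then show ?thesis using T(1) C(2) by (auto simp: strip_def)
  next
    case False
    then show ?thesis using inside[of t] that by (auto simp: strip_def)
  qed
  have "snd (x T) \<ge> 0"
  proof (rule ccontr)
    assume "\<not> ?thesis"
    then have neg: "snd (x T) < 0" "t0 < T" using T(2) x(4) by (auto simp: less_le)
    obtain d where d: "d > 0" "\<And>h. 0 < h \<Longrightarrow> h < d \<Longrightarrow> fst (x T) < fst (x (T - h))"
      using DERIV_neg_dec_left[OF solution_components(1)[OF x(1,3)] neg(1)] by blast
    have "fst (x (T - min (d / 2) (T - t0))) > pi"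
      using d(1) d(2)[of "min (d / 2) (T - t0)"] neg(2) T(1) by auto
    moreover have "T - min (d / 2) (T - t0) \<in> {t0..<T}" using d(1) neg(2) by auto
    ultimately show False using inside by (fastforce simp: strip_def)
  qed
  moreover have "open I" using x(1) by (simp add: solves_def)
  ultimately obtain e where e: "e > 0" "\<And>s. T < s \<Longrightarrow> s < T + e \<Longrightarrow> - fst (x s) < - fst (x T)"
    using decreasing_of_second_deriv_neg[OF _ x(3) DERIV_minus DERIV_minus,
        OF _ solution_components(1)[OF x(1)] solution_components(2)[OF x(1,3)]] T(1)
    by auto
  show "\<exists>s\<in>{T<..<T + e'}. x s \<in> {z. fst z > pi}" if "e' > 0" for e'
    using e T(1) that by (intro bexI[of _ "T + min e e' / 2"]) auto
qed

end

section \<open>The solution that never leaves the strip nor meets the neighbourhood\<close>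

theorem theorem2p1:
  fixes u :: "real \<Rightarrow> real \<Rightarrow> real \<Rightarrow> real"
    and t0 :: real
    and \<mu> :: "real \<times> real"
    and U :: "(real \<times> real) set"
    and V :: "real \<times> real \<Rightarrow> real"
  assumes u: "u \<in> Lip"
    and \<mu>: "\<mu> \<in> strip" "equilibrium u \<mu>"
    and U: "closedin (top_of_set strip) U" "\<mu> \<in> U - frontier U"
    and V: "C1_on U V"
    and L1: "V \<mu> = 0" "\<And>x. x \<in> U - {\<mu>} \<Longrightarrow> V x > 0"
    and L2: "\<And>q p t. (q, p) \<in> U - {\<mu>} \<Longrightarrow> orbital_deriv u V q p t < 0"
  shows "\<exists>q0 p0 B. open B \<and> \<mu> \<in> B \<and> B \<subseteq> strip \<and>
           (\<exists>x I. maximal_solution u t0 (q0, p0) x I) \<and>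
           (\<forall>x I. maximal_solution u t0 (q0, p0) x I \<longrightarrow>
              (\<forall>t\<in>I. t \<ge> t0 \<longrightarrow> x t \<in> strip - B))"
proof -
  interpret lipschitz_ode "pendulum u"
    using u by (rule pendulum_lipschitz_ode)
  note sol_iff = solution_on_iff_solves[OF u]
  \<comment> \<open>The first component of the field is \<open>p\<close>, so an equilibrium has zero
    velocity.\<close>
  obtain mq where \<mu>_eq: "\<mu> = (mq, 0)" and mq: "0 < mq" "mq < pi"
    using \<mu> by (cases \<mu>) (auto simp: equilibrium_def pendulum_def strip_def zero_prod_def)
  \<comment> \<open>Any point of \<open>(0, pi)\<close> other than \<open>mq\<close> would do: the
    segment meets \<open>p = 0\<close> only at \<open>q = c\<close>, so it misses \<mu>.\<close>
  define c where "c = (if mq = pi / 2 then pi / 4 else pi / 2)"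
  have c: "0 < c" "c < pi" "c \<noteq> mq" using mq by (auto simp: c_def)
  define Z where "Z = (\<lambda>q. (q, q - c)) ` {0..pi}"
  have Z: "compact Z" "connected Z"
    unfolding Z_def
    by (auto intro!: compact_continuous_image connected_continuous_image continuous_intros)
  have "\<mu> \<notin> Z" using c(3) by (auto simp: Z_def \<mu>_eq)
  have U_strip: "U \<subseteq> strip" using U(1) closedin_imp_subset by auto
  \<comment> \<open>\<open>U\<close> is closed only relative to the strip, but
    \<open>frontier\<close> is taken in the plane, so \<mu> is interior in the plane.\<close>
  have "\<mu> \<in> interior U" using U(2) closure_subset by (auto simp: frontier_def)
  then have "\<mu> \<in> interior U \<inter> - Z" "open (interior U \<inter> - Z)"
    using \<open>\<mu> \<notin> Z\<close> Z(1) by (auto intro: open_Int open_Compl compact_imp_closed)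
  then obtain r where r: "r > 0" "cball \<mu> r \<subseteq> interior U \<inter> - Z"
    using open_contains_cball by blast
  have r_U: "cball \<mu> r \<subseteq> U" using r(2) interior_subset by blast
  obtain W V' where W: "open W" "U \<subseteq> W"
    and V': "\<And>x. x \<in> W \<Longrightarrow> (V has_derivative blinfun_apply (V' x)) (at x)"
    using V unfolding C1_on_def by blast
  have Vc: "continuous_on S V" if "S \<subseteq> W" for S
    using V' that by (meson continuous_at_imp_continuous_on has_derivative_continuous subsetD)
  have rW: "cball \<mu> r \<subseteq> W" using r_U W(2) by blast
  have "(mq + r, 0) \<in> sphere \<mu> r"
    using r(1) by (simp add: \<mu>_eq dist_Pair_Pair dist_real_def)
  then have "sphere \<mu> r \<noteq> {}" by blast
  moreover have "sphere \<mu> r \<subseteq> W" using rW sphere_cball by (rule order_trans[rotated])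
  ultimately have "\<exists>z\<in>sphere \<mu> r. \<forall>y\<in>sphere \<mu> r. V z \<le> V y"
    by (intro continuous_attains_inf Vc compact_sphere)
  then obtain z where z: "z \<in> sphere \<mu> r" "\<And>y. y \<in> sphere \<mu> r \<Longrightarrow> V z \<le> V y"
    by blast
  \<comment> \<open>Half the minimum of \<open>V\<close> on the sphere: the level \<open>v\<close>
    is not reached there, so \<open>C\<close> stays inside the open ball.\<close>
  define v where "v = V z / 2"
  have "z \<in> U - {\<mu>}" using z(1) r r_U by auto
  then have v: "0 < v" using L1(2) by (simp add: v_def)
  define B where "B = {x \<in> ball \<mu> r. V x < v}"
  define C where "C = {x \<in> cball \<mu> r. V x \<le> v}"
  have B: "open B" "\<mu> \<in> B" "B \<subseteq> C"
  proof -
    have "open (ball \<mu> r \<inter> V -` {..<v})"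
      using rW by (intro continuous_open_preimage Vc) auto
    then show "open B" by (simp add: B_def vimage_def Int_def)
    show "\<mu> \<in> B" using r(1) v L1(1) by (simp add: B_def)
    show "B \<subseteq> C" by (auto simp: B_def C_def)
  qed
  have "closed (cball \<mu> r \<inter> V -` {..v})"
    using rW by (intro continuous_closed_preimage Vc) auto
  then have C: "closed C" by (simp add: C_def vimage_def Int_def)
  have C_ball: "C \<subseteq> ball \<mu> r"
  proof
    fix x assume x: "x \<in> C"
    then have "x \<notin> sphere \<mu> r" using z(2)[of x] v by (auto simp: C_def v_def)
    then show "x \<in> ball \<mu> r" using x by (auto simp: C_def)
  qed
  have CU: "C \<subseteq> U" using r_U by (auto simp: C_def)
  then have C_strip: "C \<subseteq> strip" using U_strip by blast
  have CZ: "C \<inter> Z = {}" using r(2) by (auto simp: C_def)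
  \<comment> \<open>On \<open>C\<close> away from \<mu> the chain rule turns (L2) into strict
    decrease of \<open>V\<close> along the solution, so \<open>V < v\<close> right after
    \<open>T\<close>; for a short time the solution also stays in the open ball.\<close>
  have enters: "\<exists>s\<in>{T<..<T + e}. x s \<in> B"
    if x: "solves x I" "T \<in> I" "x T \<in> C - {\<mu>}" and "e > 0" for x I T e
  proof -
    have x': "(x has_vector_derivative pendulum u T (x T)) (at T)"
      using x by (simp add: solves_def)
    have VxT: "(V has_derivative blinfun_apply (V' (x T))) (at (x T))"
      using V' x(3) CU W(2) by blast
    have "((\<lambda>t. V (x t)) has_derivative (\<lambda>h. blinfun_apply (V' (x T)) (h *\<^sub>R pendulum u T (x T)))) (at T)"
      using has_derivative_compose[OF x'[unfolded has_vector_derivative_def] VxT] .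
    then have Vx: "((\<lambda>t. V (x t)) has_real_derivative blinfun_apply (V' (x T)) (pendulum u T (x T))) (at T)"
      by (simp add: has_field_derivative_def blinfun.scaleR_right mult_commute_abs)
    have "orbital_deriv u V (fst (x T)) (snd (x T)) T < 0"
      by (rule L2) (use x(3) CU in auto)
    moreover have "orbital_deriv u V (fst (x T)) (snd (x T)) T
        = blinfun_apply (V' (x T)) (pendulum u T (x T))"
      using orbital_deriv_eq[of V "blinfun_apply (V' (x T))" "fst (x T)" "snd (x T)" u T] VxT
      by simp
    ultimately have "blinfun_apply (V' (x T)) (pendulum u T (x T)) < 0" by simp
    then obtain d where d: "d > 0" "\<And>h. 0 < h \<Longrightarrow> h < d \<Longrightarrow> V (x (T + h)) < V (x T)"
      using DERIV_neg_dec_right[OF Vx] by blast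
    have "isCont x T" using x' by (rule has_vector_derivative_continuous)
    moreover have "x T \<in> ball \<mu> r" using x(3) C_ball by blast
    ultimately have "\<forall>\<^sub>F s in at T. x s \<in> ball \<mu> r"
      by (metis isCont_def open_ball topological_tendstoD)
    then obtain d' where d': "d' > 0" "\<And>s. s \<noteq> T \<Longrightarrow> dist s T < d' \<Longrightarrow> x s \<in> ball \<mu> r"
      unfolding eventually_at by auto
    define h where "h = min e (min d d') / 2"
    have h: "0 < h" "h < e" "h < d" "h < d'"
      using \<open>e > 0\<close> d(1) d'(1) by (auto simp: h_def)
    have "V (x (T + h)) < v" using d(2)[of h] h x(3) by (auto simp: C_def)
    moreover have "x (T + h) \<in> ball \<mu> r" using d'(2)[of "T + h"] h by (simp add: dist_real_def)
    ultimately show ?thesis using h by (intro bexI[of _ "T + h"]) (auto simp: B_def)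
  qed
  \<comment> \<open>Each corridor avoids the targets to be separated from it. The corridor of
    \<open>A2\<close> is the whole strip because the way into \<open>B\<close> crosses the boundary
    of \<open>C\<close>.\<close>
  define A0 where "A0 = reach t0 ({z. fst z < pi} - C) {z. fst z < 0}"
  define A1 where "A1 = reach t0 ({z. fst z > 0} - C) {z. fst z > pi}"
  define A2 where "A2 = reach t0 strip B"
  have strip_eq: "strip = {z. 0 < fst z} \<inter> {z. fst z < pi}" by (auto simp: strip_def)
  have "open strip" unfolding strip_eq by (intro open_Int open_Collect_less continuous_intros)
  then have opens: "open A0" "open (A1 \<union> A2)"
    unfolding A0_def A1_def A2_def using C B(1)
    by (auto intro!: open_reach open_Un open_Diff open_Collect_less continuous_intros)
  have disj: "A0 \<inter> (A1 \<union> A2) = {}"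
    unfolding A0_def A1_def A2_def Int_Un_distrib Un_empty using B(3)
    by (intro conjI reach_disjoint) (auto simp: strip_def)
  have exits: "x t0 \<in> A0 \<union> (A1 \<union> A2)"
    if x: "solves x I" "t0 \<in> I" "x t0 \<in> Z" and t: "t \<in> I" "t0 \<le> t" "x t \<notin> strip - C" for x I t
  proof -
    define G where "G = strip - C"
    define E where "E = {t0..t} \<inter> x -` (- G)"
    have tI: "{t0..t} \<subseteq> I" using solves_Icc[OF x(1,2) t(1)] .
    have "open G" unfolding G_def using \<open>open strip\<close> C by (rule open_Diff)
    then have "closed E"
      unfolding E_def using solves_continuous_on[OF x(1) tI]
      by (intro continuous_closed_preimage) auto
    moreover have "t \<in> E" "bdd_below E"
      using t by (auto simp: E_def G_def)
    ultimately have "Inf E \<in> E" using closed_contains_Inf by blast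
    \<comment> \<open>The first time outside \<open>strip - C\<close>; it is attained because
      \<open>E\<close> is closed.\<close>
    define T where "T = Inf E"
    have T: "t0 \<le> T" "T \<le> t" "x T \<notin> G"
      using \<open>Inf E \<in> E\<close> by (auto simp: T_def E_def)
    have inside: "x s \<in> G" if "s \<in> {t0..<T}" for s
    proof (rule ccontr)
      assume "x s \<notin> G"
      then have "s \<in> E" using that T(2) by (auto simp: E_def)
      then show False using cInf_lower[OF _ \<open>bdd_below E\<close>] that by (fastforce simp: T_def)
    qed
    have TI: "T \<in> I" using T tI by auto
    \<comment> \<open>By continuity the first exit happens within the closed strip, which leaves
      only \<open>C\<close> and the two walls as exit places.\<close>
    have fst_T: "0 \<le> fst (x T) \<and> fst (x T) \<le> pi"
    proof (cases "T = t0")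
      case True
      then show ?thesis using x(3) by (auto simp: Z_def)
    next
      case False
      have cl: "closure {t0..<T} = {t0..T}" using False T(1) by simp
      have "continuous_on (closure {t0..<T}) (\<lambda>s. fst (x s))"
        unfolding cl using tI T by (intro continuous_intros solves_continuous_on[OF x(1)]) auto
      note lower = continuous_ge_on_closure[OF this] and upper = continuous_le_on_closure[OF this]
      have T_cl: "T \<in> closure {t0..<T}" using cl T(1) by simp
      have bounds: "0 \<le> fst (x s)" "fst (x s) \<le> pi" if "s \<in> {t0..<T}" for s
        using inside[OF that] by (auto simp: G_def strip_def)
      show ?thesis using lower[OF T_cl bounds(1)] upper[OF T_cl bounds(2)] by simp
    qed
    consider "x T \<in> C" | "x T \<notin> C" "fst (x T) = 0" | "x T \<notin> C" "fst (x T) = pi"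
      using T(3) fst_T by (fastforce simp: G_def strip_eq)
    then show ?thesis
    proof cases
      case 1
      have stay: "x s \<in> strip" if "s \<in> {t0..T}" for s
        using that inside[of s] 1 C_strip by (cases "s = T") (auto simp: G_def)
      have "x t0 \<in> A2"
        unfolding A2_def
      proof (cases "x T \<in> B")
        case True
        then show "x t0 \<in> reach t0 strip B"
          unfolding reach_def using x TI T(1) stay by blast
      next
        case False
        \<comment> \<open>Since \<mu> lies in \<open>B\<close>, a point of \<open>C\<close> outside
          \<open>B\<close> is one where \<open>V\<close> strictly decreases.\<close>
        then have "x T \<in> C - {\<mu>}" using 1 B(2) by auto
        then show "x t0 \<in> reach t0 strip B"
          using enters[OF x(1) TI] stay \<open>open strip\<close>
          by (intro reach_immediately[OF x(1,2) TI T(1)]) auto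
      qed
      then show ?thesis by simp
    next
      case 2
      have "snd (x T) < 0" if "T = t0"
        using x(3) 2(2) that c by (auto simp: Z_def)
      then have "x t0 \<in> A0"
        unfolding A0_def using inside 2
        by (intro left_exit[OF u C C_strip x(1,2) TI T(1)]) (auto simp: G_def)
      then show ?thesis by simp
    next
      case 3
      have "snd (x T) > 0" if "T = t0"
        using x(3) 3(2) that c by (auto simp: Z_def)
      then have "x t0 \<in> A1"
        unfolding A1_def using inside 3
        by (intro right_exit[OF u C C_strip x(1,2) TI T(1)]) (auto simp: G_def)
      then show ?thesis by simp
    qed
  qed
  \<comment> \<open>Keeps the final claim about all maximal solutions from being vacuous.\<close>
  have maximal: "\<exists>x I. maximal_solution u t0 z x I" for z
    unfolding maximal_solution_def sol_iff by (rule maximal_solution_exists)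
  \<comment> \<open>The endpoints of the segment already lie on the walls with outward velocity, so
    the exit lemmas apply with \<open>T = t0\<close> and an empty past.\<close>
  have "(0, - c) \<in> A0"
  proof -
    obtain x I where x: "solves x I" "t0 \<in> I" "x t0 = (0, - c)"
      using local_solution by blast
    have "x t0 \<in> A0"
      unfolding A0_def
      by (rule left_exit[OF u C C_strip x(1,2,2)]) (use c x(3) in auto)
    then show ?thesis using x(3) by simp
  qed
  moreover have "(0, - c) \<in> Z" by (force simp: Z_def)
  moreover have "(pi, pi - c) \<in> A1"
  proof -
    obtain x I where x: "solves x I" "t0 \<in> I" "x t0 = (pi, pi - c)"
      using local_solution by blast
    have "x t0 \<in> A1"
      unfolding A1_def
      by (rule right_exit[OF u C C_strip x(1,2,2)]) (use c x(3) in auto)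
    then show ?thesis using x(3) by simp
  qed
  moreover have "(pi, pi - c) \<in> Z" by (force simp: Z_def)
  ultimately have "A0 \<inter> Z \<noteq> {}" "(A1 \<union> A2) \<inter> Z \<noteq> {}" by auto
  \<comment> \<open>Otherwise \<open>A0\<close> and \<open>A1 \<union> A2\<close> would be disjoint
    open sets, both meeting the connected \<open>Z\<close> and together covering it.\<close>
  then have "\<not> Z \<subseteq> A0 \<union> (A1 \<union> A2)"
    using connectedD[OF Z(2) opens] disj by fastforce
  then obtain w where w: "w \<in> Z" "w \<notin> A0 \<union> (A1 \<union> A2)"
    unfolding subset_eq by blast
  obtain q0 p0 where "w = (q0, p0)" by (rule prod.exhaust)
  then have good: "(q0, p0) \<in> Z" "(q0, p0) \<notin> A0 \<union> (A1 \<union> A2)" using w by simp_all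
  have "x t \<in> strip - B" if "maximal_solution u t0 (q0, p0) x I" "t \<in> I" "t0 \<le> t" for x I t
  proof (rule ccontr)
    have x: "solves x I" "t0 \<in> I" "x t0 = (q0, p0)"
      using that(1) by (auto simp: maximal_solution_def sol_iff)
    assume "x t \<notin> strip - B"
    \<comment> \<open>As \<open>B\<close> is contained in \<open>C\<close>, leaving
      \<open>strip - B\<close> means leaving the smaller set \<open>strip - C\<close>, to which
      \<open>exits\<close> applies.\<close>
    then have "x t \<notin> strip - C" using B(3) by blast
    then have "x t0 \<in> A0 \<union> (A1 \<union> A2)"
      using good(1) by (intro exits[OF x(1,2) _ that(2,3)]) (simp_all add: x(3))
    then show False using good(2) x(3) by simp
  qed
  moreover have "B \<subseteq> strip" using B(3) C_strip by blast
  ultimately show ?thesis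
    using B(1,2) maximal[of "(q0, p0)"]
    by (intro exI[of _ q0] exI[of _ p0] exI[of _ B] conjI allI impI ballI) simp_all
qed

end
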